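(* Let $\mathbb{K}\in\{\mathbb{R},\mathbb{C}\}$ and let $X$ be an infinite-dimensional normed vector space over $\mathbb{K}$. Let $U\neq\emptyset$ be a convex open subset of $X$ and let $L$ be a linear subspace of $X$ with $\operatorname{codim} L\geq 2$. Then $U\setminus L$ is dense in $U$ and pathwise connected.
   Context: $\operatorname{codim} L$ denotes the (possibly finite, possibly infinite cardinal) algebraic codimension of $L$ in $X$: $\operatorname{codim} L=\kappa$ iff some Hamel basis $B$ of $X$ has a subset $B'$ with $\operatorname{span}(B')=L$ and $|B\setminus B'|=\kappa$. Topological notions refer to the norm topology. *)

theory Defs
  imports "HOL-Analysis.Analysis"
begin

text \<open>A scalar multiplication by the field 'k on a real normed vector space that makes it a
  normed vector space over 'k, compatible with the given real structure. For 'k = complex this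
  is exactly a complex normed vector space structure (the complex normed space viewed, as
  usual, also as a real normed space).\<close>
definition normed_scaling :: "('k::real_normed_field \<Rightarrow> 'a::real_normed_vector \<Rightarrow> 'a) \<Rightarrow> bool" where
  "normed_scaling sc \<longleftrightarrow> vector_space sc
     \<and> (\<forall>r x. sc (of_real r) x = scaleR r x)
     \<and> (\<forall>c x. norm (sc c x) = norm c * norm x)"

text \<open>Finite-dimensionality over the scalar field given by sc.\<close>
definition fin_dim :: "('k::field \<Rightarrow> 'a::ab_group_add \<Rightarrow> 'a) \<Rightarrow> bool" where
  "fin_dim sc \<longleftrightarrow> (\<exists>S. finite S \<and> module.span sc S = UNIV)"

text \<open>Algebraic codimension of L is at least 2: some Hamel basis B has a subset B' spanning L
  with at least two elements of B outside B'.\<close>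
definition codim_ge2 :: "('k::field \<Rightarrow> 'a::ab_group_add \<Rightarrow> 'a) \<Rightarrow> 'a set \<Rightarrow> bool" where
  "codim_ge2 sc L \<longleftrightarrow> (\<exists>B B'. \<not> module.dependent sc B \<and> module.span sc B = UNIV
      \<and> B' \<subseteq> B \<and> module.span sc B' = L
      \<and> (\<exists>b1 b2. b1 \<in> B - B' \<and> b2 \<in> B - B' \<and> b1 \<noteq> b2))"

end

theory Submission
  imports Defs
begin

text \<open>Codimension at least 2 yields two vectors \<open>b\<^sub>1, b\<^sub>2\<close> that are linearly
  independent modulo \<open>L\<close>. Density needs only \<open>b\<^sub>1 \<notin> L\<close>: a point \<open>x \<in> U \<inter> L\<close> is the limit of
  \<open>x + t b\<^sub>1 \<in> U - L\<close>. For path-connectedness take \<open>x, y \<in> U - L\<close> whose segment meets \<open>L\<close>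
  at \<open>z\<close>. Since \<open>x \<notin> L\<close>, one of \<open>b\<^sub>1, b\<^sub>2\<close>, say \<open>w\<close>, is independent of \<open>x\<close> modulo \<open>L\<close>, and
  then the plane \<open>x + span {y - x, w}\<close> meets \<open>L\<close> only in the line through \<open>z\<close> parallel to
  \<open>y - x\<close>. So the path \<open>x \<rightarrow> x + \<epsilon>w \<rightarrow> y + \<epsilon>w \<rightarrow> y\<close> avoids \<open>L\<close>, and for small \<open>\<epsilon>\<close> it
  stays in \<open>U\<close> by openness and convexity. Over \<open>\<complex>\<close> the same argument applies to the underlying
  real space.\<close>

definition independent_mod :: "('k::field \<Rightarrow> 'a::ab_group_add \<Rightarrow> 'a) \<Rightarrow> 'a set \<Rightarrow> 'a \<Rightarrow> 'a \<Rightarrow> bool"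
  where "independent_mod sc L u v \<longleftrightarrow> (\<forall>a b. sc a u + sc b v \<in> L \<longrightarrow> a = 0 \<and> b = 0)"

lemma (in vector_space) basis_vector_coeff_zero_mod_span:
  assumes "\<not> dependent B" "B' \<subseteq> B" "u \<in> B - B'" "v \<in> B - {u}"
    and "scale a u + scale b v \<in> span B'"
  shows "a = 0"
proof (rule ccontr)
  assume "a \<noteq> 0"
  have "span B' \<subseteq> span (B - {u})"
    using assms(2,3) by (intro span_mono) auto
  moreover have "scale b v \<in> span (B - {u})"
    using assms(4) by (intro span_scale span_base)
  ultimately have "scale a u \<in> span (B - {u})"
    using assms(5) span_diff by fastforce
  then have "scale (inverse a) (scale a u) \<in> span (B - {u})"
    by (rule span_scale)
  with \<open>a \<noteq> 0\<close> have "u \<in> span (B - {u})"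
    by simp
  with assms(1,3) show False
    unfolding dependent_def by blast
qed

lemma codim_ge2_imp_independent_mod:
  assumes "vector_space sc" "codim_ge2 sc L"
  shows "\<exists>b\<^sub>1 b\<^sub>2. independent_mod sc L b\<^sub>1 b\<^sub>2"
proof -
  interpret vector_space sc by fact
  obtain B B' b\<^sub>1 b\<^sub>2 where B: "\<not> dependent B" "B' \<subseteq> B" "span B' = L"
    and b: "b\<^sub>1 \<in> B - B'" "b\<^sub>2 \<in> B - B'" "b\<^sub>1 \<noteq> b\<^sub>2"
    using assms(2) unfolding codim_ge2_def by blast
  have "a = 0 \<and> c = 0" if "sc a b\<^sub>1 + sc c b\<^sub>2 \<in> L" for a c
  proof
    show "a = 0"
      using basis_vector_coeff_zero_mod_span[OF B(1,2)] b that B(3) by blast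
    show "c = 0"
      using basis_vector_coeff_zero_mod_span[OF B(1,2), of b\<^sub>2 b\<^sub>1 c a] b that B(3)
      by (simp add: add.commute)
  qed
  then show ?thesis
    unfolding independent_mod_def by blast
qed

lemma subspace_of_real_scaling:
  fixes sc :: "'k::real_field \<Rightarrow> 'a::real_vector \<Rightarrow> 'a"
  assumes "vector_space sc" "\<And>r x. sc (of_real r) x = r *\<^sub>R x" "module.subspace sc L"
  shows "subspace L"
  using assms module.subspace_def[of sc L] unfolding subspace_def module_iff_vector_space
  by metis

lemma independent_mod_of_real_scaling:
  fixes sc :: "'k::real_field \<Rightarrow> 'a::real_vector \<Rightarrow> 'a"
  assumes "\<And>r x. sc (of_real r) x = r *\<^sub>R x" "independent_mod sc L u v"
  shows "independent_mod (*\<^sub>R) L u v"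
  using assms unfolding independent_mod_def by (metis of_real_eq_0_iff)

lemma independent_mod_imp_notin:
  assumes "subspace L" "independent_mod (*\<^sub>R) L u v"
  shows "u \<notin> L"
  using assms subspace_0[of L] unfolding independent_mod_def
  by (metis add.right_neutral one_neq_zero scale_one scale_zero_left)

text \<open>The exchange step: eliminating \<open>x\<close> from two dependencies would give one between \<open>u\<close>
  and \<open>v\<close>.\<close>
lemma independent_mod_exchange:
  assumes L: "subspace L" and uv: "independent_mod (*\<^sub>R) L u v" and "x \<notin> L"
  shows "independent_mod (*\<^sub>R) L x u \<or> independent_mod (*\<^sub>R) L x v"
proof (rule ccontr)
  assume "\<not> ?thesis"
  then obtain a\<^sub>1 c\<^sub>1 a\<^sub>2 c\<^sub>2 where
    dep\<^sub>1: "a\<^sub>1 *\<^sub>R x + c\<^sub>1 *\<^sub>R u \<in> L" "a\<^sub>1 \<noteq> 0 \<or> c\<^sub>1 \<noteq> 0" and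
    dep\<^sub>2: "a\<^sub>2 *\<^sub>R x + c\<^sub>2 *\<^sub>R v \<in> L" "a\<^sub>2 \<noteq> 0 \<or> c\<^sub>2 \<noteq> 0"
    unfolding independent_mod_def by blast
  have x_coeff: "a = 0" if "a *\<^sub>R x \<in> L" for a
  proof (rule ccontr)
    assume "a \<noteq> 0"
    then have "x = inverse a *\<^sub>R (a *\<^sub>R x)"
      by simp
    with that L \<open>x \<notin> L\<close> show False
      using subspace_scale by metis
  qed
  have "c\<^sub>2 \<noteq> 0"
    using dep\<^sub>2 x_coeff by auto
  have "a\<^sub>1 \<noteq> 0"
    using dep\<^sub>1 x_coeff uv subspace_0[OF L] unfolding independent_mod_def
    by (metis add.commute add.right_neutral scale_zero_left)
  have "a\<^sub>2 *\<^sub>R (a\<^sub>1 *\<^sub>R x + c\<^sub>1 *\<^sub>R u) - a\<^sub>1 *\<^sub>R (a\<^sub>2 *\<^sub>R x + c\<^sub>2 *\<^sub>R v) \<in> L"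
    using dep\<^sub>1 dep\<^sub>2 L by (intro subspace_diff subspace_scale)
  also have "a\<^sub>2 *\<^sub>R (a\<^sub>1 *\<^sub>R x + c\<^sub>1 *\<^sub>R u) - a\<^sub>1 *\<^sub>R (a\<^sub>2 *\<^sub>R x + c\<^sub>2 *\<^sub>R v)
      = (a\<^sub>2 * c\<^sub>1) *\<^sub>R u + (- (a\<^sub>1 * c\<^sub>2)) *\<^sub>R v"
    by (simp add: algebra_simps)
  finally have "a\<^sub>1 * c\<^sub>2 = 0"
    using uv unfolding independent_mod_def by fastforce
  with \<open>a\<^sub>1 \<noteq> 0\<close> \<open>c\<^sub>2 \<noteq> 0\<close> show False
    by simp
qed

lemma plane_meets_subspace_on_line:
  assumes L: "subspace L" and "independent_mod (*\<^sub>R) L x w" "s \<noteq> 0"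
    and "(1 - s) *\<^sub>R x + s *\<^sub>R y \<in> L" "(1 - u) *\<^sub>R x + u *\<^sub>R y + \<tau> *\<^sub>R w \<in> L"
  shows "u = s \<and> \<tau> = 0"
proof -
  have "s *\<^sub>R ((1 - u) *\<^sub>R x + u *\<^sub>R y + \<tau> *\<^sub>R w) - u *\<^sub>R ((1 - s) *\<^sub>R x + s *\<^sub>R y) \<in> L"
    using assms(4,5) L by (intro subspace_diff subspace_scale)
  also have "s *\<^sub>R ((1 - u) *\<^sub>R x + u *\<^sub>R y + \<tau> *\<^sub>R w) - u *\<^sub>R ((1 - s) *\<^sub>R x + s *\<^sub>R y)
      = (s - u) *\<^sub>R x + (s * \<tau>) *\<^sub>R w"
    by (simp add: algebra_simps)
  finally have "s - u = 0 \<and> s * \<tau> = 0"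
    using assms(2) unfolding independent_mod_def by blast
  with \<open>s \<noteq> 0\<close> show ?thesis
    by simp
qed

lemma eventually_translate_in_open:
  fixes x w :: "'a::real_normed_vector"
  assumes "open U" "x \<in> U"
  shows "\<forall>\<^sub>F t in at 0. x + t *\<^sub>R w \<in> U"
proof -
  have "((\<lambda>t. x + t *\<^sub>R w) \<longlongrightarrow> x + 0 *\<^sub>R w) (at 0)"
    by (intro tendsto_intros)
  then show ?thesis
    using assms by (simp add: topological_tendstoD)
qed

lemma open_subset_closure_diff_subspace:
  fixes U :: "'a::real_normed_vector set"
  assumes "open U" "subspace L" "b \<notin> L"
  shows "U \<subseteq> closure (U - L)"
proof
  fix x assume "x \<in> U"
  show "x \<in> closure (U - L)"
  proof (cases "x \<in> L")
    case False
    with \<open>x \<in> U\<close> show ?thesis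
      using closure_subset by blast
  next
    case True
    have "x + t *\<^sub>R b \<notin> L" if "t \<noteq> 0" for t
      using that True assms(2,3) subspace_diff[of L "x + t *\<^sub>R b" x]
        subspace_scale[of L "t *\<^sub>R b" "inverse t"] by auto
    then have "\<forall>\<^sub>F t in at 0. x + t *\<^sub>R b \<in> closure (U - L)"
      using eventually_translate_in_open[OF \<open>open U\<close> \<open>x \<in> U\<close>, of b]
      by (auto simp: eventually_at_filter elim!: eventually_mono intro: closure_subset[THEN subsetD])
    moreover have "((\<lambda>t. x + t *\<^sub>R b) \<longlongrightarrow> x) (at 0)"
      by (auto intro!: tendsto_eq_intros)
    ultimately show ?thesis
      by (intro Lim_in_closed_set[OF closed_closure _ trivial_limit_at])
  qed
qed

lemma convex_open_diff_subspace_path_connected: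
  fixes U :: "'a::real_normed_vector set"
  assumes U: "convex U" "open U" and L: "subspace L" and b: "independent_mod (*\<^sub>R) L b\<^sub>1 b\<^sub>2"
  shows "path_connected (U - L)"
  unfolding path_connected_component
proof (intro ballI)
  fix x y assume x: "x \<in> U - L" and y: "y \<in> U - L"
  have segment: "path_component (U - L) p q"
    if "p \<in> U" "q \<in> U" "\<And>t. 0 \<le> t \<Longrightarrow> t \<le> 1 \<Longrightarrow> (1 - t) *\<^sub>R p + t *\<^sub>R q \<notin> L" for p q
  proof (rule path_component_linepath)
    show "closed_segment p q \<subseteq> U - L"
      using that closed_segment_subset[OF _ _ \<open>convex U\<close>] unfolding closed_segment_def by blast
  qed
  show "path_component (U - L) x y"
  proof (cases "\<exists>s. 0 \<le> s \<and> s \<le> 1 \<and> (1 - s) *\<^sub>R x + s *\<^sub>R y \<in> L")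
    case False
    with x y show ?thesis
      by (intro segment) auto
  next
    case True
    then obtain s where s: "(1 - s) *\<^sub>R x + s *\<^sub>R y \<in> L"
      by blast
    have "s \<noteq> 0" "s \<noteq> 1"
      using s x y by auto
    obtain w where w: "independent_mod (*\<^sub>R) L x w"
      using independent_mod_exchange[OF L b] x by blast
    have avoid: "(1 - u) *\<^sub>R x + u *\<^sub>R y + \<tau> *\<^sub>R w \<notin> L" if "u = 0 \<or> u = 1 \<or> \<tau> \<noteq> 0" for u \<tau>
      using that plane_meets_subspace_on_line[OF L w \<open>s \<noteq> 0\<close> s] \<open>s \<noteq> 0\<close> \<open>s \<noteq> 1\<close> by metis
    have "\<forall>\<^sub>F t in at_right 0. 0 < t \<and> x + t *\<^sub>R w \<in> U \<and> y + t *\<^sub>R w \<in> U"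
      using eventually_translate_in_open[OF \<open>open U\<close>, of _ w] x y
      by (intro eventually_conj eventually_at_right_less) (auto simp: eventually_at_split)
    then obtain \<epsilon> :: real where \<epsilon>: "0 < \<epsilon>" "x + \<epsilon> *\<^sub>R w \<in> U" "y + \<epsilon> *\<^sub>R w \<in> U"
      using eventually_happens'[OF trivial_limit_at_right_real] by blast
    have "path_component (U - L) x (x + \<epsilon> *\<^sub>R w)"
      using x \<epsilon> avoid[of 0 "_ * \<epsilon>"] by (intro segment) (auto simp: algebra_simps)
    moreover have "path_component (U - L) (x + \<epsilon> *\<^sub>R w) (y + \<epsilon> *\<^sub>R w)"
      using \<epsilon> avoid[of _ \<epsilon>] by (intro segment) (auto simp: algebra_simps)
    moreover have "path_component (U - L) (y + \<epsilon> *\<^sub>R w) y"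
      using y \<epsilon> avoid[of 1 "(1 - _) * \<epsilon>"] by (intro segment) (auto simp: algebra_simps)
    ultimately show ?thesis
      by (meson path_component_trans)
  qed
qed

lemma convex_open_diff_subspace_dense_path_connected:
  fixes U :: "'a::real_normed_vector set"
  assumes "convex U" "open U" "subspace L" "independent_mod (*\<^sub>R) L b\<^sub>1 b\<^sub>2"
  shows "U \<subseteq> closure (U - L) \<and> path_connected (U - L)"
  using assms open_subset_closure_diff_subspace independent_mod_imp_notin
    convex_open_diff_subspace_path_connected by metis

theorem lemma1:
  fixes sc :: "complex \<Rightarrow> 'b::real_normed_vector \<Rightarrow> 'b"
  shows "(\<forall>(U::'a::real_normed_vector set) L.
            \<not> fin_dim ((*\<^sub>R) :: real \<Rightarrow> 'a \<Rightarrow> 'a) \<and> convex U \<and> open U \<and> U \<noteq> {}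
            \<and> subspace L \<and> codim_ge2 ((*\<^sub>R) :: real \<Rightarrow> 'a \<Rightarrow> 'a) L
            \<longrightarrow> U \<subseteq> closure (U - L) \<and> path_connected (U - L))
       \<and> (normed_scaling sc \<longrightarrow>
          (\<forall>(U::'b set) L.
            \<not> fin_dim sc \<and> convex U \<and> open U \<and> U \<noteq> {}
            \<and> module.subspace sc L \<and> codim_ge2 sc L
            \<longrightarrow> U \<subseteq> closure (U - L) \<and> path_connected (U - L)))"
proof (rule conjI; intro allI impI; elim conjE)
  fix U L :: "'a set"
  assume "convex U" "open U" "subspace L" "codim_ge2 (*\<^sub>R) L"
  then show "U \<subseteq> closure (U - L) \<and> path_connected (U - L)"
    using codim_ge2_imp_independent_mod[OF real_vector.vector_space_axioms]
      convex_open_diff_subspace_dense_path_connected by metis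
next
  fix U L :: "'b set"
  assume sc: "normed_scaling sc" and "convex U" "open U" "module.subspace sc L" "codim_ge2 sc L"
  have "vector_space sc" and of_real_sc: "\<And>r x. sc (of_real r) x = r *\<^sub>R x"
    using sc unfolding normed_scaling_def by auto
  then obtain b\<^sub>1 b\<^sub>2 where "independent_mod (*\<^sub>R) L b\<^sub>1 b\<^sub>2"
    using codim_ge2_imp_independent_mod independent_mod_of_real_scaling \<open>codim_ge2 sc L\<close> by metis
  moreover have "subspace L"
    using subspace_of_real_scaling \<open>vector_space sc\<close> of_real_sc \<open>module.subspace sc L\<close> by metis
  ultimately show "U \<subseteq> closure (U - L) \<and> path_connected (U - L)"
    using \<open>convex U\<close> \<open>open U\<close> convex_open_diff_subspace_dense_path_connected by blast
qed

end
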